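(* Consider the nonlinear time-delay system $$\dot x(t)=Ax(t)+Bu(t)+f(x(t),x(t-\tau),u(t)),\qquad y(t)=Cx(t),$$ with state $x\in\mathbb{R}^n$, input $u\in\mathbb{R}$, output $y\in\mathbb{R}$ and known constant delay $\tau>0$, where $A,B,C,f$ are as described in the context (chain-of-integrators $A,B,C$; $f$ smooth, triangular, globally Lipschitz in its first two arguments uniformly in $u$, $f(0,0,u)=0$). Let $K=[k_1,\dots,k_n]$ be such that $A_K:=A+BK$ is Hurwitz, and let $S$ be the symmetric positive definite solution of $A_K^TS+SA_K=-I$. Suppose there exists $\theta>0$ such that $$\frac{\theta}{2}-\|S\|\frac{\ln\theta}{2\tau}-3k\|S\|>0\quad\text{and}\quad\frac{\sqrt\theta}{2}-k\|S\|>0,$$ where $k$ is the Lipschitz constant described in the context. Let $K(\theta)=[k_1\theta^n,k_2\theta^{n-1},\dots,k_n\theta]$. Then the closed-loop time-delay system obtained with the state feedback $u=K(\theta)x$ is globally rationally stable.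
   Context: Matrices: $A\in\mathbb{R}^{n\times n}$ has $A_{i,i+1}=1$ for $1\le i\le n-1$ and all other entries $0$; $B=[0,\dots,0,1]^T\in\mathbb{R}^n$; $C=[1,0,\dots,0]\in\mathbb{R}^{1\times n}$. Nonlinearity: $f(y,z,u)=(f_1,\dots,f_n)^T$ with $y,z\in\mathbb{R}^n$, $u\in\mathbb{R}$, where $f_i$ depends only on $y_1,\dots,y_i,z_1,\dots,z_i,u$. It is assumed that $f$ is smooth, globally Lipschitz with respect to $y$ and $z$ uniformly with respect to $u$, and $f(0,0,u)=0$ for all $u$. The delay $\tau$ is known and constant. $\|\cdot\|$ is the Euclidean norm on vectors and the induced norm on matrices. For $\theta>0$ let $\Delta_\theta=\mathrm{diag}[1,\frac1\theta,\dots,\frac1{\theta^{n-1}}]$. The constant (not to be confused with the gains $k_i$) is $k=\max(\ell_1,\ell_2)$, where $\ell_1,\ell_2\ge0$ are Lipschitz constants for which $$\|\Delta_\theta(f(\hat y,\hat z,u)-f(y,z,u))\|\le \ell_1\|\Delta_\theta(\hat y-y)\|+\ell_2\|\Delta_\theta(\hat z-z)\|$$ for all $y,\hat y,z,\hat z\in\mathbb{R}^n$, $u\in\mathbb{R}$. Global rational stability of (the zero solution of) a time-delay system with solution $x(t)$ and continuous initial function $\varphi$ on $[-\tau,0]$, $\|\varphi\|_\infty=\max_{s\in[-\tau,0]}\|\varphi(s)\|$, means: (stability) for every $\varepsilon>0$ there is $\delta>0$ such that $\|\varphi\|_\infty<\delta$ implies $\|x(t)\|<\varepsilon$ for all $t\ge0$;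 moreover $\delta$ can be chosen arbitrarily large for sufficiently large $\varepsilon$; and for every $\sigma>0$ there exist positive numbers $M,\kappa,e$ with $e\le1$ such that $\|\varphi\|_\infty<\sigma$ implies $$\|x(t)\|\le\frac{M\|\varphi\|_\infty^{e}}{(1+\|\varphi\|_\infty^{\kappa}t)^{1/\kappa}}\quad\text{for all }t\ge0.$$
   Formalization: The formal statement requires θ ≥ 1 rather than θ > 0; for θ < 1 the claim fails, e.g. n=1, f=y/25, K=-1, S=1/2, τ=1, θ=1/100, k=1/25 satisfies both conditions but the closed loop is x'=0.03x. *)

theory Defs
  imports "HOL-Analysis.Analysis"
begin

text \<open>
  Vectors in \<open>\<real>\<^sup>n\<close> are elements of \<open>real ^ 'n\<close> for a finite linearly ordered index type
  \<open>'n\<close> with \<open>CARD('n) = n\<close>.  \<open>pos i\<close> is the position of the index \<open>i\<close> in that order,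
  counted from 1, so that \<open>pos\<close> is the order isomorphism of \<open>'n\<close> with \<open>{1..n}\<close>.
\<close>

type_synonym 'n rvec = "(real, 'n) vec"
type_synonym 'n rmat = "((real, 'n) vec, 'n) vec"

definition pos :: "'n::{finite,linorder} \<Rightarrow> nat" where
  "pos i = card {j. j \<le> i}"

definition chain_A :: "'n::{finite,linorder} rmat" where
  "chain_A = (\<chi> i j. if pos j = pos i + 1 then 1 else 0)"

definition chain_B :: "'n::{finite,linorder} rvec" where
  "chain_B = (\<chi> i. if pos i = CARD('n) then 1 else 0)"

text \<open>The row matrix \<open>C\<close> is represented by the vector \<open>c\<close> with \<open>C x = c \<bullet> x\<close>; likewise for the
  gain rows \<open>K\<close> and \<open>K(\<theta>)\<close>.\<close>

definition chain_C :: "'n::{finite,linorder} rvec" where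
  "chain_C = (\<chi> i. if pos i = 1 then 1 else 0)"

definition high_gain :: "real \<Rightarrow> 'n rvec \<Rightarrow> 'n::{finite,linorder} rvec" where
  "high_gain \<theta> K = (\<chi> i. K $ i * \<theta> ^ (CARD('n) + 1 - pos i))"

definition scaling :: "real \<Rightarrow> 'n::{finite,linorder} rmat" where
  "scaling \<theta> = (\<chi> i j. if i = j then 1 / \<theta> ^ (pos i - 1) else 0)"

definition hurwitz :: "'n::finite rmat \<Rightarrow> bool" where
  "hurwitz M \<longleftrightarrow>
     (\<forall>(\<mu>::complex) v. v \<noteq> 0 \<and> map_matrix complex_of_real M *v v = \<mu> *s v \<longrightarrow> Re \<mu> < 0)"

definition pos_def_matrix :: "'n::finite rmat \<Rightarrow> bool" where
  "pos_def_matrix M \<longleftrightarrow> (\<forall>x. x \<noteq> 0 \<longrightarrow> x \<bullet> (M *v x) > 0)"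

abbreviation mat_norm :: "real ^ 'n ^ 'm \<Rightarrow> real" where
  "mat_norm M \<equiv> onorm ((*v) M)"

primrec times_differentiable ::
    "nat \<Rightarrow> ('a::real_normed_vector \<Rightarrow> 'b::real_normed_vector) \<Rightarrow> bool" where
  "times_differentiable 0 g \<longleftrightarrow> continuous_on UNIV g"
| "times_differentiable (Suc m) g \<longleftrightarrow>
     (\<forall>x. g differentiable (at x)) \<and>
     (\<forall>v. times_differentiable m (\<lambda>x. frechet_derivative g (at x) v))"

definition smooth :: "('a::real_normed_vector \<Rightarrow> 'b::real_normed_vector) \<Rightarrow> bool" where
  "smooth g \<longleftrightarrow> (\<forall>m. times_differentiable m g)"

definition triangular ::
    "('n rvec \<Rightarrow> 'n rvec \<Rightarrow> real \<Rightarrow> 'n::{finite,linorder} rvec) \<Rightarrow> bool" where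
  "triangular f \<longleftrightarrow>
     (\<forall>i y y' z z' u. (\<forall>j\<le>i. y $ j = y' $ j \<and> z $ j = z' $ j) \<longrightarrow> f y z u $ i = f y' z' u $ i)"

definition uniformly_globally_lipschitz ::
    "('n rvec \<Rightarrow> 'n rvec \<Rightarrow> real \<Rightarrow> 'n::finite rvec) \<Rightarrow> bool" where
  "uniformly_globally_lipschitz f \<longleftrightarrow> (\<exists>L. \<forall>u. L-lipschitz_on UNIV (\<lambda>(y, z). f y z u))"

text \<open>
  \<open>scaled_lipschitz f \<theta> l\<^sub>1 l\<^sub>2\<close> says that \<open>l\<^sub>1\<close>, \<open>l\<^sub>2\<close> are Lipschitz constants of \<open>f\<close> in the
  coordinates scaled by \<open>\<Delta>\<^sub>\<theta>\<close>.  For triangular globally Lipschitz \<open>f\<close> there are constants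
  that work for all \<open>\<theta> \<ge> 1\<close>; for \<open>\<theta> < 1\<close> they depend on \<open>\<theta>\<close> in general.  Moreover, for
  \<open>\<theta> < 1\<close> the gain conditions do not imply stability: take \<open>n = 1\<close>, \<open>f(y,z,u) = y/25\<close>,
  \<open>K = -1\<close>, \<open>\<theta> = 1/100\<close>, \<open>\<tau> = 1\<close>, where the closed loop is \<open>x' = 3x/100\<close>.
\<close>

definition scaled_lipschitz ::
    "('n rvec \<Rightarrow> 'n rvec \<Rightarrow> real \<Rightarrow> 'n::{finite,linorder} rvec)
      \<Rightarrow> real \<Rightarrow> real \<Rightarrow> real \<Rightarrow> bool" where
  "scaled_lipschitz f \<theta> l\<^sub>1 l\<^sub>2 \<longleftrightarrow>
     (\<forall>y y' z z' u. norm (scaling \<theta> *v (f y' z' u - f y z u))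
        \<le> l\<^sub>1 * norm (scaling \<theta> *v (y' - y)) + l\<^sub>2 * norm (scaling \<theta> *v (z' - z)))"

text \<open>Trajectories live on \<open>[-\<tau>, \<infinity>)\<close>; at time \<open>0\<close> the derivative is one-sided.\<close>

definition plant_trajectory ::
    "real \<Rightarrow> ('n rvec \<Rightarrow> 'n rvec \<Rightarrow> real \<Rightarrow> 'n::{finite,linorder} rvec)
      \<Rightarrow> (real \<Rightarrow> 'n rvec) \<Rightarrow> (real \<Rightarrow> real) \<Rightarrow> (real \<Rightarrow> real) \<Rightarrow> bool" where
  "plant_trajectory \<tau> f x u y \<longleftrightarrow>
     continuous_on {-\<tau>..} x \<and>
     (\<forall>t\<ge>0. (x has_vector_derivative
               (chain_A *v x t + u t *\<^sub>R chain_B + f (x t) (x (t - \<tau>)) (u t))) (at t within {0..}) \<and>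
             y t = chain_C \<bullet> x t)"

definition closed_loop ::
    "real \<Rightarrow> ('n rvec \<Rightarrow> 'n rvec \<Rightarrow> real \<Rightarrow> 'n::{finite,linorder} rvec)
      \<Rightarrow> 'n rvec \<Rightarrow> (real \<Rightarrow> 'n rvec) \<Rightarrow> bool" where
  "closed_loop \<tau> f K x \<longleftrightarrow> (\<exists>y. plant_trajectory \<tau> f x (\<lambda>t. K \<bullet> x t) y)"

definition sup_norm :: "real \<Rightarrow> (real \<Rightarrow> 'a::real_normed_vector) \<Rightarrow> real" where
  "sup_norm \<tau> \<phi> = (SUP s\<in>{-\<tau>..0}. norm (\<phi> s))"

text \<open>A time-delay system with delay \<open>\<tau>\<close> is given by its set \<open>X\<close> of solutions on \<open>[-\<tau>, \<infinity>)\<close>.\<close>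

definition solution_from ::
    "real \<Rightarrow> ((real \<Rightarrow> 'a::real_normed_vector) \<Rightarrow> bool) \<Rightarrow> (real \<Rightarrow> 'a) \<Rightarrow> (real \<Rightarrow> 'a) \<Rightarrow> bool" where
  "solution_from \<tau> X \<phi> x \<longleftrightarrow>
     continuous_on {-\<tau>..0} \<phi> \<and> X x \<and> (\<forall>s\<in>{-\<tau>..0}. x s = \<phi> s)"

definition stability_margin ::
    "real \<Rightarrow> ((real \<Rightarrow> 'a::real_normed_vector) \<Rightarrow> bool) \<Rightarrow> real \<Rightarrow> real \<Rightarrow> bool" where
  "stability_margin \<tau> X \<epsilon> \<delta> \<longleftrightarrow>
     (\<forall>\<phi> x. solution_from \<tau> X \<phi> x \<and> sup_norm \<tau> \<phi> < \<delta> \<longrightarrow> (\<forall>t\<ge>0. norm (x t) < \<epsilon>))"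

definition globally_rationally_stable ::
    "real \<Rightarrow> ((real \<Rightarrow> 'a::real_normed_vector) \<Rightarrow> bool) \<Rightarrow> bool" where
  "globally_rationally_stable \<tau> X \<longleftrightarrow>
     (\<forall>\<epsilon>>0. \<exists>\<delta>>0. stability_margin \<tau> X \<epsilon> \<delta>) \<and>
     (\<forall>R>0. \<exists>\<epsilon>\<^sub>0>0. \<forall>\<epsilon>\<ge>\<epsilon>\<^sub>0. \<exists>\<delta>\<ge>R. stability_margin \<tau> X \<epsilon> \<delta>) \<and>
     (\<forall>\<sigma>>0. \<exists>M>0. \<exists>\<kappa>>0. \<exists>e>0. e \<le> 1 \<and>
        (\<forall>\<phi> x. solution_from \<tau> X \<phi> x \<and> sup_norm \<tau> \<phi> < \<sigma> \<longrightarrow>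
          (\<forall>t\<ge>0. norm (x t) \<le>
             M * sup_norm \<tau> \<phi> powr e / (1 + sup_norm \<tau> \<phi> powr \<kappa> * t) powr (1 / \<kappa>))))"

end

theory Submission
  imports Defs
begin

text \<open>
  In the scaled state \<open>\<eta> = \<Delta>\<^sub>\<theta> x\<close> the closed loop becomes
  \<open>\<eta>' = \<theta> A\<^sub>K \<eta> + \<Delta>\<^sub>\<theta> f\<close>.  With \<open>V = \<eta>\<^sup>T S \<eta>\<close> the Lyapunov--Krasovskii functional
  \<open>V + \<theta>/2 \<integral>\<^bsub>t-\<tau>\<^esub>\<^bsup>t\<^esup> e\<^bsup>\<mu>(s-t)\<^esup> \<parallel>\<eta>(s)\<parallel>\<^sup>2 ds\<close> decays like \<open>e\<^bsup>-\<mu>t\<^esup>\<close> as soon as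
  \<open>\<theta>/2 - \<mu>\<parallel>S\<parallel> - 3k\<parallel>S\<parallel> \<ge> 0\<close> and \<open>\<theta>/2 e\<^bsup>-\<mu>\<tau>\<^esup> - k\<parallel>S\<parallel> \<ge> 0\<close>.  At \<open>\<mu> = ln \<theta> / (2\<tau>)\<close> these are
  the two gain conditions; since those are strict, a slightly larger \<open>\<mu>\<close> also works, so the rate
  is positive even for \<open>\<theta> = 1\<close>.  The resulting exponential estimate implies rational stability.
\<close>

section \<open>The scaling matrix and the linear part of the closed loop in scaled
  coordinates\<close>

lemma pos_ge_1: "1 \<le> pos (i::'n::{finite,linorder})"
  unfolding pos_def by (metis One_nat_def Suc_leI card_gt_0_iff empty_iff finite mem_Collect_eq order_refl)

lemma pos_le_CARD: "pos (i::'n::{finite,linorder}) \<le> CARD('n)"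
  unfolding pos_def by (rule card_mono) auto

lemma scaling_mult_nth:
  "(scaling \<theta> *v x) $ i = x $ i / \<theta> ^ (pos (i::'n::{finite,linorder}) - 1)"
proof -
  have "(scaling \<theta> *v x) $ i = (\<Sum>j\<in>UNIV. if i = j then x $ j / \<theta> ^ (pos i - 1) else 0)"
    unfolding scaling_def matrix_vector_mult_def vec_lambda_beta
    by (rule sum.cong) simp_all
  then show ?thesis by simp
qed

text \<open>For \<open>\<theta> \<ge> 1\<close> every diagonal entry lies in (0, 1]. This bounds the
  scaled initial function by the original one.\<close>

lemma norm_scaling_le:
  fixes x :: "'n::{finite,linorder} rvec"
  assumes "\<theta> \<ge> 1"
  shows "norm (scaling \<theta> *v x) \<le> norm x"
proof (rule norm_le_componentwise_cart)
  fix i :: 'n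
  have "1 \<le> \<theta> ^ (pos i - 1)" using assms by (rule one_le_power)
  then show "norm ((scaling \<theta> *v x) $ i) \<le> norm (x $ i)"
    by (simp add: scaling_mult_nth divide_le_eq abs_mult mult_le_cancel_left1)
qed

text \<open>Carries the final estimate back from the scaled state to \<open>x\<close>. Undoing the
  scaling multiplies a coordinate by at most \<open>\<theta>\<close> to the power n - 1; the
  exponent \<open>CARD('n)\<close> is slightly coarser.\<close>

lemma norm_le_scaling:
  fixes x :: "'n::{finite,linorder} rvec"
  assumes "\<theta> \<ge> 1"
  shows "norm x \<le> \<theta> ^ CARD('n) * norm (scaling \<theta> *v x)"
proof -
  have "norm x \<le> norm (\<theta> ^ CARD('n) *\<^sub>R (scaling \<theta> *v x))"
  proof (rule norm_le_componentwise_cart)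
    fix i :: 'n
    have "\<theta> ^ (pos i - 1) \<le> \<theta> ^ CARD('n)"
      using assms pos_le_CARD[of i] by (intro power_increasing) auto
    moreover have "0 < \<theta> ^ (pos i - 1)" using assms by simp
    ultimately show "norm (x $ i) \<le> norm ((\<theta> ^ CARD('n) *\<^sub>R (scaling \<theta> *v x)) $ i)"
      using assms by (simp add: scaling_mult_nth abs_mult divide_le_eq le_divide_eq mult_left_mono mult.commute[of _ "\<bar>x $ i\<bar>"])
  qed
  then show ?thesis using assms by simp
qed

text \<open>Conjugation by the scaling multiplies each superdiagonal entry of the chain by
  \<open>\<theta>\<close>, and the exponents in \<open>high_gain\<close> are those for which the
  feedback in the last row also becomes \<open>\<theta>\<close> times \<open>K\<close> acting on the
  scaled state.\<close>

lemma scaling_linear_part: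
  fixes x K :: "'n::{finite,linorder} rvec"
  assumes "\<theta> > 0"
  shows "scaling \<theta> *v (chain_A *v x + (high_gain \<theta> K \<bullet> x) *\<^sub>R chain_B)
       = \<theta> *\<^sub>R ((chain_A + columnvector chain_B ** (rowvector K :: 'n rvec ^ 1)) *v (scaling \<theta> *v x))"
proof -
  have A: "(\<Sum>j\<in>UNIV. (if pos j = pos i + 1 then 1 else 0) * x $ j) / \<theta> ^ (pos i - 1)
         = \<theta> * (\<Sum>j\<in>UNIV. (if pos j = pos i + 1 then 1 else 0) * (x $ j / \<theta> ^ (pos j - 1)))" for i :: 'n
  proof -
    have "\<theta> ^ pos i = \<theta> * \<theta> ^ (pos i - 1)"
      using pos_ge_1[of i] by (simp flip: power_Suc)
    then show ?thesis
      unfolding sum_divide_distrib sum_distrib_left using assms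
      by (intro sum.cong) (auto simp: field_simps)
  qed
  have B: "(\<Sum>j\<in>UNIV. K $ j * \<theta> ^ (CARD('n) + 1 - pos j) * x $ j) / \<theta> ^ (CARD('n) - 1)
         = \<theta> * (\<Sum>j\<in>UNIV. K $ j * (x $ j / \<theta> ^ (pos j - 1)))"
  proof -
    have "\<theta> ^ (CARD('n) + 1 - pos j) * \<theta> ^ (pos j - 1) = \<theta> * \<theta> ^ (CARD('n) - 1)" for j :: 'n
    proof -
      \<comment> \<open>Positions run from 1 to n, so none of the truncated subtractions loses
        anything.\<close>
      have "CARD('n) + 1 - pos j + (pos j - 1) = Suc (CARD('n) - 1)"
        using pos_ge_1[of j] pos_le_CARD[of j] by simp
      then show ?thesis by (metis power_add power_Suc)
    qed
    then have "\<theta> ^ (CARD('n) + 1 - pos j) / \<theta> ^ (CARD('n) - 1) = \<theta> / \<theta> ^ (pos j - 1)" for j :: 'n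
      using assms by (simp add: frac_eq_eq)
    then have "K $ j * \<theta> ^ (CARD('n) + 1 - pos j) * x $ j / \<theta> ^ (CARD('n) - 1)
        = \<theta> * (K $ j * (x $ j / \<theta> ^ (pos j - 1)))" for j :: 'n
      by (metis (no_types, opaque_lifting) mult.assoc mult.commute times_divide_eq_right)
    then show ?thesis
      unfolding sum_divide_distrib sum_distrib_left by (rule sum.cong[OF refl])
  qed
  show ?thesis
    unfolding vec_eq_iff
  proof
    fix i :: 'n
    have "(chain_A + columnvector chain_B ** (rowvector K :: 'n rvec ^ 1)) $ i $ j
        = (if pos j = pos i + 1 then 1 else 0) + (if pos i = CARD('n) then 1 else 0) * K $ j" for j
      by (simp add: chain_A_def chain_B_def matrix_matrix_mult_def columnvector_def rowvector_def)
    then have "((chain_A + columnvector chain_B ** (rowvector K :: 'n rvec ^ 1)) *v (scaling \<theta> *v x)) $ i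
       = (\<Sum>j\<in>UNIV. (if pos j = pos i + 1 then 1 else 0) * (x $ j / \<theta> ^ (pos j - 1)))
         + (if pos i = CARD('n) then 1 else 0) * (\<Sum>j\<in>UNIV. K $ j * (x $ j / \<theta> ^ (pos j - 1)))"
      unfolding matrix_vector_mult_def[of "chain_A + _"] vec_lambda_beta
      by (simp only: scaling_mult_nth distrib_right sum.distrib sum_distrib_left mult.assoc)
    moreover have "(chain_A *v x) $ i = (\<Sum>j\<in>UNIV. (if pos j = pos i + 1 then 1 else 0) * x $ j)"
      unfolding matrix_vector_mult_def chain_A_def vec_lambda_beta ..
    then have "(scaling \<theta> *v (chain_A *v x + (high_gain \<theta> K \<bullet> x) *\<^sub>R chain_B)) $ i
       = (\<Sum>j\<in>UNIV. (if pos j = pos i + 1 then 1 else 0) * x $ j) / \<theta> ^ (pos i - 1)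
       + (if pos i = CARD('n) then 1 else 0)
         * ((\<Sum>j\<in>UNIV. K $ j * \<theta> ^ (CARD('n) + 1 - pos j) * x $ j) / \<theta> ^ (CARD('n) - 1))"
      by (simp add: scaling_mult_nth chain_B_def high_gain_def inner_vec_def add_divide_distrib)
    ultimately show "(scaling \<theta> *v (chain_A *v x + (high_gain \<theta> K \<bullet> x) *\<^sub>R chain_B)) $ i
      = (\<theta> *\<^sub>R ((chain_A + columnvector chain_B ** (rowvector K :: 'n rvec ^ 1)) *v (scaling \<theta> *v x))) $ i"
      unfolding A B by (simp add: distrib_left)
  qed
qed

section \<open>Quadratic forms and the Lyapunov equation\<close>

lemma pos_def_matrix_coercive:
  fixes S :: "'n::finite rmat"
  assumes "pos_def_matrix S"
  obtains c where "c > 0" "\<And>x. c * (norm x)\<^sup>2 \<le> x \<bullet> (S *v x)"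
proof -
  \<comment> \<open>The constant is the minimum of the quadratic form on the compact unit sphere;
    homogeneity of degree two extends the bound to all vectors.\<close>
  have "continuous_on (sphere 0 1) (\<lambda>x::'n rvec. x \<bullet> (S *v x))"
    by (intro continuous_intros matrix_vector_mult_linear_continuous_on)
  moreover have "sphere 0 1 \<noteq> ({} :: 'n rvec set)"
    by simp
  ultimately obtain v :: "'n rvec" where v: "v \<in> sphere 0 1"
      "\<And>y. y \<in> sphere 0 1 \<Longrightarrow> v \<bullet> (S *v v) \<le> y \<bullet> (S *v y)"
    using continuous_attains_inf[OF compact_sphere] by blast
  have "v \<noteq> 0" using v(1) by auto
  show ?thesis
  proof
    show "v \<bullet> (S *v v) > 0"
      using assms \<open>v \<noteq> 0\<close> unfolding pos_def_matrix_def by blast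
    fix x
    show "v \<bullet> (S *v v) * (norm x)\<^sup>2 \<le> x \<bullet> (S *v x)"
    proof (cases "x = 0")
      case False
      then have "v \<bullet> (S *v v) \<le> (x /\<^sub>R norm x) \<bullet> (S *v (x /\<^sub>R norm x))"
        by (intro v(2)) simp
      also have "\<dots> = (x \<bullet> (S *v x)) / (norm x)\<^sup>2"
        by (simp add: matrix_vector_mult_scaleR power2_eq_square divide_simps)
      finally show ?thesis using False by (simp add: le_divide_eq)
    qed simp
  qed
qed

lemma inner_mult_vec_le:
  fixes M :: "'n::finite rmat"
  shows "x \<bullet> (M *v y) \<le> mat_norm M * norm x * norm y"
proof -
  have "x \<bullet> (M *v y) \<le> norm x * norm (M *v y)" by (rule norm_cauchy_schwarz)
  also have "\<dots> \<le> norm x * (mat_norm M * norm y)"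
    by (intro mult_left_mono onorm matrix_vector_mul_bounded_linear) simp
  finally show ?thesis by (simp add: mult_ac)
qed

text \<open>Since \<open>S\<close> is symmetric, both products in the matrix equation have the same
  quadratic form, which accounts for the factor 2.\<close>

lemma lyapunov_equation_inner:
  fixes M S :: "'n::finite rmat"
  assumes "transpose S = S" "transpose M ** S + S ** M = - mat 1"
  shows "2 * (x \<bullet> (S *v (M *v x))) = - (norm x)\<^sup>2"
proof -
  have "x \<bullet> ((transpose M ** S) *v x) = x \<bullet> ((S ** M) *v x)"
    using assms(1)
    by (metis dot_lmul_matrix inner_commute matrix_vector_mul_assoc transpose_matrix_vector)
  moreover have "x \<bullet> ((transpose M ** S) *v x) + x \<bullet> ((S ** M) *v x) = - (norm x)\<^sup>2"
  proof -
    have "x \<bullet> ((transpose M ** S) *v x) + x \<bullet> ((S ** M) *v x) = x \<bullet> ((- mat 1) *v x)"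
      by (metis assms(2) inner_add_right matrix_vector_mult_add_rdistrib)
    also have "(- mat 1) *v x = - x"
      using matrix_vector_mult_diff_rdistrib[of 0 "mat 1" x] by simp
    finally show ?thesis by (simp add: power2_norm_eq_inner)
  qed
  ultimately show ?thesis by (simp add: matrix_vector_mul_assoc)
qed

lemma has_real_derivative_quadratic_form:
  fixes S :: "'n::finite rmat"
  assumes "transpose S = S" "(\<eta> has_vector_derivative d) (at t within T)"
  shows "((\<lambda>t. \<eta> t \<bullet> (S *v \<eta> t)) has_real_derivative 2 * (\<eta> t \<bullet> (S *v d))) (at t within T)"
proof -
  have "((\<lambda>t. S *v \<eta> t) has_vector_derivative S *v d) (at t within T)"
    by (rule bounded_linear.has_vector_derivative[OF matrix_vector_mul_bounded_linear assms(2)])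
  then have "((\<lambda>t. \<eta> t \<bullet> (S *v \<eta> t)) has_vector_derivative \<eta> t \<bullet> (S *v d) + d \<bullet> (S *v \<eta> t)) (at t within T)"
    by (rule bounded_bilinear.has_vector_derivative[OF bounded_bilinear_inner assms(2)])
  moreover have "d \<bullet> (S *v \<eta> t) = \<eta> t \<bullet> (S *v d)"
    using assms(1) by (metis dot_lmul_matrix inner_commute transpose_matrix_vector)
  ultimately show ?thesis by (simp add: has_real_derivative_iff_has_vector_derivative)
qed

section \<open>Decay of a delay functional, and rational stability from decay\<close>

text \<open>The sum of \<open>exp (\<mu> * t) * V t\<close> and \<open>q\<close> times the integral
  of \<open>exp (\<mu> * s) * w s\<close> over the last delay interval never increases: sliding the
  window adds the current value and removes the delayed one, which offsets the right-hand side of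
  the differential inequality.\<close>

lemma krasovskii_decay:
  fixes V V' w :: "real \<Rightarrow> real"
  assumes "\<tau> > 0" "\<mu> \<ge> 0" "q \<ge> 0"
    and w: "continuous_on {-\<tau>..} w" "\<And>t. w t \<ge> 0"
    and V: "\<And>t. t \<ge> 0 \<Longrightarrow> (V has_real_derivative V' t) (at t within {0..})"
    and le: "\<And>t. t \<ge> 0 \<Longrightarrow> V' t + \<mu> * V t \<le> - q * w t + q * exp (- \<mu> * \<tau>) * w (t - \<tau>)"
    and N: "\<And>s. s \<in> {-\<tau>..0} \<Longrightarrow> w s \<le> N"
    and "t \<ge> 0"
  shows "exp (\<mu> * t) * V t \<le> V 0 + q * \<tau> * N"
proof -
  define h where "h s = exp (\<mu> * s) * w s" for s
  \<comment> \<open>As a difference of two values of one primitive, the moving window is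
    differentiated by the chain rule. Starting at \<open>-\<tau>\<close> covers every delayed
    argument.\<close>
  define I where "I s = integral {-\<tau>..s} h" for s
  define J where "J s = exp (\<mu> * s) * V s + q * (I s - I (s - \<tau>))" for s
  have h: "continuous_on {-\<tau>..t} h"
    unfolding h_def by (intro continuous_intros continuous_on_subset[OF w(1)]) auto
  have int: "h integrable_on {a..b}" if "-\<tau> \<le> a" "b \<le> t" for a b
    by (rule integrable_continuous_real, rule continuous_on_subset[OF h]) (use that in auto)
  have I: "(I has_real_derivative h s) (at s within {-\<tau>..t})" if "s \<in> {-\<tau>..t}" for s
    unfolding I_def has_real_derivative_iff_has_vector_derivative
    by (rule integral_has_vector_derivative[OF h that])
  have J: "(J has_real_derivative exp (\<mu> * s) * (V' s + \<mu> * V s) + q * (h s - h (s - \<tau>)))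
      (at s within {0..t})" if "s \<in> {0..t}" for s
  proof -
    have V_s: "(V has_real_derivative V' s) (at s within {0..t})"
      using that by (intro DERIV_subset[OF V]) auto
    have I_s: "(I has_real_derivative h s) (at s within {0..t})"
      using that \<open>\<tau> > 0\<close> by (intro DERIV_subset[OF I]) auto
    have "(I has_real_derivative h (s - \<tau>)) (at (s - \<tau>) within (\<lambda>r. r - \<tau>) ` {0..t})"
      using that \<open>\<tau> > 0\<close> by (intro DERIV_subset[OF I]) auto
    moreover have "((\<lambda>r. r - \<tau>) has_real_derivative 1) (at s within {0..t})"
      by (auto intro!: derivative_eq_intros)
    ultimately have "(I \<circ> (\<lambda>r. r - \<tau>) has_real_derivative h (s - \<tau>) * 1) (at s within {0..t})"
      by (rule DERIV_image_chain)
    then have I_shift: "((\<lambda>r. I (r - \<tau>)) has_real_derivative h (s - \<tau>)) (at s within {0..t})"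
      by (simp add: o_def)
    show ?thesis
      unfolding J_def
      by (rule derivative_eq_intros V_s I_s I_shift refl)+ (simp add: algebra_simps)
  qed
  \<comment> \<open>The sign of the derivative is checked only at interior points, where the
    derivative within the closed interval is two-sided; continuity covers the endpoints.\<close>
  have "J t \<le> J 0"
  proof (rule DERIV_nonpos_imp_decreasing_open[OF \<open>t \<ge> 0\<close>])
    show "continuous_on {0..t} J"
      unfolding continuous_on_eq_continuous_within using J by (blast intro: DERIV_continuous)
    fix s assume s: "0 < s" "s < t"
    have "h s - h (s - \<tau>) = exp (\<mu> * s) * (w s - exp (- \<mu> * \<tau>) * w (s - \<tau>))"
      by (simp add: h_def algebra_simps exp_diff exp_minus divide_inverse)
    then have "exp (\<mu> * s) * (V' s + \<mu> * V s) + q * (h s - h (s - \<tau>))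
        = exp (\<mu> * s) * (V' s + \<mu> * V s - (- q * w s + q * exp (- \<mu> * \<tau>) * w (s - \<tau>)))"
      by (simp only:) (simp add: algebra_simps)
    also have "\<dots> \<le> 0"
      using le[of s] s by (intro mult_nonneg_nonpos) auto
    finally show "\<exists>y. (J has_real_derivative y) (at s) \<and> y \<le> 0"
      using J[of s] s by (auto simp: at_within_Icc_at)
  qed
  moreover have "exp (\<mu> * t) * V t \<le> J t"
  proof -
    have "I (t - \<tau>) \<le> I t"
      unfolding I_def using \<open>t \<ge> 0\<close> \<open>\<tau> > 0\<close> w(2)
      by (intro integral_subset_le int) (auto simp: h_def)
    then show ?thesis using \<open>q \<ge> 0\<close> by (simp add: J_def)
  qed
  moreover have "J 0 \<le> V 0 + q * \<tau> * N"
  proof -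
    have "integral {-\<tau>..0} h \<le> integral {-\<tau>..0} (\<lambda>_. N)"
    proof (rule integral_le)
      fix s assume s: "s \<in> {-\<tau>..0}"
      \<comment> \<open>On the initial interval the weight is at most 1, because
        \<open>s \<le> 0\<close> and \<open>\<mu> \<ge> 0\<close>.\<close>
      have "h s \<le> 1 * w s"
        unfolding h_def using w(2)[of s] s \<open>\<mu> \<ge> 0\<close>
        by (intro mult_right_mono) (auto simp: mult_nonneg_nonpos)
      then show "h s \<le> N" using N[OF s] by simp
    qed (use int \<open>t \<ge> 0\<close> in auto)
    then have "integral {-\<tau>..0} h \<le> \<tau> * N" using \<open>\<tau> > 0\<close> by simp
    then show ?thesis
      using \<open>q \<ge> 0\<close> by (simp add: J_def I_def mult.assoc mult_left_mono)
  qed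
  ultimately show ?thesis by linarith
qed

text \<open>An exponential beats the linear growth of \<open>1 + p * t\<close> uniformly for
  \<open>p < \<sigma>\<close>, so the rational bound holds with \<open>\<kappa> = e = 1\<close>, and
  only \<open>M\<close> depends on \<open>\<sigma>\<close>.\<close>

lemma globally_rationally_stable_if_exponential:
  fixes X :: "(real \<Rightarrow> 'a::real_normed_vector) \<Rightarrow> bool"
  assumes "\<tau> > 0" "C > 0" "\<rho> > 0"
    and le: "\<And>\<phi> x t. solution_from \<tau> X \<phi> x \<Longrightarrow> t \<ge> 0 \<Longrightarrow> norm (x t) \<le> C * exp (- \<rho> * t) * sup_norm \<tau> \<phi>"
  shows "globally_rationally_stable \<tau> X"
proof -
  \<comment> \<open>Nonnegativity of the supremum is read off from the estimate at time 0.\<close>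
  have nonneg: "sup_norm \<tau> \<phi> \<ge> 0" if "solution_from \<tau> X \<phi> x" for \<phi> x
    using order_trans[OF norm_ge_zero le[OF that order_refl]] \<open>C > 0\<close> by (simp add: zero_le_mult_iff)
  \<comment> \<open>One choice serves both margin clauses: \<open>\<epsilon> / C\<close> is positive
    for positive \<open>\<epsilon>\<close> and unbounded as \<open>\<epsilon>\<close> grows.\<close>
  have margin: "stability_margin \<tau> X \<epsilon> (\<epsilon> / C)" for \<epsilon>
    unfolding stability_margin_def
  proof (intro allI impI)
    fix \<phi> x and t :: real
    assume *: "solution_from \<tau> X \<phi> x \<and> sup_norm \<tau> \<phi> < \<epsilon> / C" and "0 \<le> t"
    have "norm (x t) \<le> C * exp (- \<rho> * t) * sup_norm \<tau> \<phi>" using * \<open>0 \<le> t\<close> le by blast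
    also have "\<dots> \<le> C * 1 * sup_norm \<tau> \<phi>"
      using * nonneg assms \<open>0 \<le> t\<close> by (intro mult_right_mono mult_left_mono) auto
    also have "\<dots> < \<epsilon>" using * \<open>C > 0\<close> by (simp add: field_simps)
    finally show "norm (x t) < \<epsilon>" .
  qed
  show ?thesis
    unfolding globally_rationally_stable_def
  proof (intro conjI allI impI)
    fix \<epsilon> :: real assume "\<epsilon> > 0"
    then show "\<exists>\<delta>>0. stability_margin \<tau> X \<epsilon> \<delta>"
      using margin \<open>C > 0\<close> by (intro exI[of _ "\<epsilon> / C"]) simp
  next
    fix R :: real assume "R > 0"
    show "\<exists>\<epsilon>\<^sub>0>0. \<forall>\<epsilon>\<ge>\<epsilon>\<^sub>0. \<exists>\<delta>\<ge>R. stability_margin \<tau> X \<epsilon> \<delta>"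
    proof (rule exI[of _ "R * C"], intro conjI allI impI)
      fix \<epsilon> assume "\<epsilon> \<ge> R * C"
      then show "\<exists>\<delta>\<ge>R. stability_margin \<tau> X \<epsilon> \<delta>"
        using margin \<open>C > 0\<close> by (intro exI[of _ "\<epsilon> / C"]) (simp add: le_divide_eq)
    qed (use \<open>R > 0\<close> \<open>C > 0\<close> in simp)
  next
    fix \<sigma> :: real assume "\<sigma> > 0"
    \<comment> \<open>The factor \<open>1 + \<sigma> / \<rho>\<close> bounds
      \<open>exp (- \<rho> * t) * (1 + p * t)\<close>, because both 1 and \<open>\<rho> * t\<close>
      are at most \<open>exp (\<rho> * t)\<close>.\<close>
    define M where "M = C * (1 + \<sigma> / \<rho>)"
    have "M > 0" using assms \<open>\<sigma> > 0\<close> unfolding M_def by (intro mult_pos_pos add_pos_pos) auto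
    moreover have "norm (x t) \<le> M * sup_norm \<tau> \<phi> powr 1 / (1 + sup_norm \<tau> \<phi> powr 1 * t) powr (1 / 1)"
      if sol: "solution_from \<tau> X \<phi> x" and small: "sup_norm \<tau> \<phi> < \<sigma>" and "t \<ge> 0" for \<phi> x t
    proof -
      define p where "p = sup_norm \<tau> \<phi>"
      have p: "p \<ge> 0" "p < \<sigma>" using nonneg[OF sol] small by (auto simp: p_def)
      have "1 + p * t \<le> 1 + \<sigma> * t" using p \<open>t \<ge> 0\<close> by (simp add: mult_right_mono)
      also have "\<dots> \<le> 1 + \<sigma> / \<rho> * (\<rho> * t)" using assms by simp
      also have "\<dots> \<le> exp (\<rho> * t) + \<sigma> / \<rho> * exp (\<rho> * t)"
      proof (intro add_mono mult_left_mono)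
        show "\<rho> * t \<le> exp (\<rho> * t)" using exp_ge_add_one_self[of "\<rho> * t"] by linarith
      qed (use assms \<open>t \<ge> 0\<close> \<open>\<sigma> > 0\<close> in auto)
      finally have "C * exp (- \<rho> * t) * (1 + p * t) \<le> C * exp (- \<rho> * t) * ((1 + \<sigma> / \<rho>) * exp (\<rho> * t))"
        using \<open>C > 0\<close> by (intro mult_left_mono) (auto simp: algebra_simps)
      also have "\<dots> = M" by (simp add: M_def exp_minus)
      finally have "C * exp (- \<rho> * t) * (1 + p * t) * p \<le> M * p"
        using p by (intro mult_right_mono) auto
      moreover have "1 + p * t > 0" using p \<open>t \<ge> 0\<close> by (simp add: add_pos_nonneg)
      ultimately have "C * exp (- \<rho> * t) * p \<le> M * p / (1 + p * t)"
        by (simp add: le_divide_eq mult_ac)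
      then have "norm (x t) \<le> M * p / (1 + p * t)" using le[OF sol \<open>t \<ge> 0\<close>] by (simp add: p_def)
      then show ?thesis using p \<open>1 + p * t > 0\<close> by (simp add: p_def)
    qed
    ultimately show "\<exists>M>0. \<exists>\<kappa>>0. \<exists>e>0. e \<le> 1 \<and>
        (\<forall>\<phi> x. solution_from \<tau> X \<phi> x \<and> sup_norm \<tau> \<phi> < \<sigma> \<longrightarrow>
          (\<forall>t\<ge>0. norm (x t) \<le>
             M * sup_norm \<tau> \<phi> powr e / (1 + sup_norm \<tau> \<phi> powr \<kappa> * t) powr (1 / \<kappa>)))"
      by - (rule exI[of _ M], rule conjI, assumption, (rule exI[of _ "1::real"], rule conjI, simp)+, auto)
  qed
qed

lemma norm_le_sup_norm:
  assumes "continuous_on {-\<tau>..0} \<phi>" "s \<in> {-\<tau>..0}"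
  shows "norm (\<phi> s) \<le> sup_norm \<tau> \<phi>"
  unfolding sup_norm_def
proof (rule cSUP_upper[OF assms(2)])
  have "compact ((\<lambda>s. norm (\<phi> s)) ` {-\<tau>..0})"
    by (intro compact_continuous_image continuous_on_norm assms(1)) simp
  then show "bdd_above ((\<lambda>s. norm (\<phi> s)) ` {-\<tau>..0})"
    by (intro bounded_imp_bdd_above compact_imp_bounded)
qed

text \<open>Supplies the rate for the Lyapunov function, with \<open>m\<close> the norm of
  \<open>S\<close>. Of the last two inequalities obtained, the first pays for the undelayed terms
  and the second for the delayed one.\<close>

lemma decay_rate_exists:
  fixes \<theta> \<tau> k m :: real
  assumes "\<tau> > 0" "\<theta> \<ge> 1"
    and "\<theta> / 2 - m * (ln \<theta> / (2 * \<tau>)) - 3 * k * m > 0" "sqrt \<theta> / 2 - k * m > 0"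
  obtains \<mu> where "\<mu> > 0" "\<theta> / 2 - \<mu> * m - 3 * k * m > 0" "\<theta> / 2 * exp (- \<mu> * \<tau>) - k * m > 0"
proof -
  define \<mu>\<^sub>0 where "\<mu>\<^sub>0 = ln \<theta> / (2 * \<tau>)"
  have "\<mu>\<^sub>0 \<ge> 0" unfolding \<mu>\<^sub>0_def using assms by simp
  have "exp (- \<mu>\<^sub>0 * \<tau>) = 1 / sqrt \<theta>"
    using assms by (simp add: \<mu>\<^sub>0_def exp_minus powr_half_sqrt[symmetric] powr_def field_simps)
  then have "\<theta> / 2 * exp (- \<mu>\<^sub>0 * \<tau>) = sqrt \<theta> / 2"
    using assms by (simp add: real_div_sqrt)
  then have at0: "\<theta> / 2 * exp (- \<mu>\<^sub>0 * \<tau>) - k * m > 0" "\<theta> / 2 - \<mu>\<^sub>0 * m - 3 * k * m > 0"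
    using assms by (simp_all add: \<mu>\<^sub>0_def mult.commute)
  \<comment> \<open>Positivity persists near \<open>\<mu>\<^sub>0\<close> by continuity; approaching
    from the right gives \<open>\<mu>\<close> strictly above
    \<open>\<mu>\<^sub>0 \<ge> 0\<close>.\<close>
  have "((\<lambda>\<mu>. \<theta> / 2 * exp (- \<mu> * \<tau>) - k * m) \<longlongrightarrow> \<theta> / 2 * exp (- \<mu>\<^sub>0 * \<tau>) - k * m) (at_right \<mu>\<^sub>0)"
    "((\<lambda>\<mu>. \<theta> / 2 - \<mu> * m - 3 * k * m) \<longlongrightarrow> \<theta> / 2 - \<mu>\<^sub>0 * m - 3 * k * m) (at_right \<mu>\<^sub>0)"
    by (intro tendsto_intros)+
  then have "\<forall>\<^sub>F \<mu> in at_right \<mu>\<^sub>0. \<theta> / 2 * exp (- \<mu> * \<tau>) - k * m > 0"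
    "\<forall>\<^sub>F \<mu> in at_right \<mu>\<^sub>0. \<theta> / 2 - \<mu> * m - 3 * k * m > 0"
    using at0 order_tendstoD(1) by blast+
  then have "\<forall>\<^sub>F \<mu> in at_right \<mu>\<^sub>0. \<mu> > \<mu>\<^sub>0 \<and> \<theta> / 2 * exp (- \<mu> * \<tau>) - k * m > 0
      \<and> \<theta> / 2 - \<mu> * m - 3 * k * m > 0"
    by (intro eventually_conj eventually_at_right_less)
  then obtain \<mu> where "\<mu> > \<mu>\<^sub>0" "\<theta> / 2 * exp (- \<mu> * \<tau>) - k * m > 0" "\<theta> / 2 - \<mu> * m - 3 * k * m > 0"
    using eventually_happens'[OF trivial_limit_at_right_real] by blast
  with \<open>\<mu>\<^sub>0 \<ge> 0\<close> show thesis by (intro that[of \<mu>]) auto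
qed

section \<open>The exponential estimate for the closed loop\<close>

theorem theorem4:
  fixes f :: "'n rvec \<Rightarrow> 'n rvec \<Rightarrow> real \<Rightarrow> 'n::{finite,linorder} rvec"
    and K :: "'n rvec"
    and A\<^sub>K S :: "'n rmat"
    and \<tau> \<theta> l\<^sub>1 l\<^sub>2 k :: real
  assumes "\<tau> > 0"
    and "smooth (\<lambda>(y, z, u). f y z u)"
    and "triangular f"
    and "uniformly_globally_lipschitz f"
    and "\<And>u. f 0 0 u = 0"
    and "A\<^sub>K = chain_A + columnvector chain_B ** (rowvector K :: 'n rvec ^ 1)"
    and "hurwitz A\<^sub>K"
    and "transpose S = S"
    and "pos_def_matrix S"
    and "transpose A\<^sub>K ** S + S ** A\<^sub>K = - mat 1"
    and "\<theta> > 0"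
    and theta_ge_1: "\<theta> \<ge> 1"
    and "l\<^sub>1 \<ge> 0" and "l\<^sub>2 \<ge> 0"
    and "scaled_lipschitz f \<theta> l\<^sub>1 l\<^sub>2"
    and "k = max l\<^sub>1 l\<^sub>2"
    and "\<theta> / 2 - mat_norm S * (ln \<theta> / (2 * \<tau>)) - 3 * k * mat_norm S > 0"
    and "sqrt \<theta> / 2 - k * mat_norm S > 0"
  shows "globally_rationally_stable \<tau> (closed_loop \<tau> f (high_gain \<theta> K))"
proof -
  define m where "m = mat_norm S"
  have "m \<ge> 0"
    unfolding m_def by (intro onorm_pos_le matrix_vector_mul_bounded_linear)
  have "k \<ge> 0" "l\<^sub>1 \<le> k" "l\<^sub>2 \<le> k" using assms by auto
  obtain \<mu> where \<mu>: "\<mu> > 0" "\<theta> / 2 - \<mu> * m - 3 * k * m > 0" "\<theta> / 2 * exp (- \<mu> * \<tau>) - k * m > 0"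
    using decay_rate_exists assms unfolding m_def by metis
  obtain c where c: "c > 0" "\<And>x. c * (norm x)\<^sup>2 \<le> x \<bullet> (S *v x)"
    using pos_def_matrix_coercive assms by blast
  \<comment> \<open>\<open>G\<close> bounds the initial value of the functional per unit of
    \<open>p\<^sup>2\<close>: \<open>m\<close> comes from the quadratic form,
    \<open>\<theta> / 2 * \<tau>\<close> from the memory integral.\<close>
  define G where "G = m + \<theta> / 2 * \<tau>"
  have "G > 0" using \<open>m \<ge> 0\<close> assms by (simp add: G_def add_nonneg_pos)
  \<comment> \<open>The square root passes from squared norms to norms; the power of
    \<open>\<theta>\<close> undoes the scaling.\<close>
  define C where "C = \<theta> ^ CARD('n) * sqrt (G / c)"
  have "C > 0" using \<open>G > 0\<close> c(1) assms by (simp add: C_def)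
  show ?thesis
  proof (rule globally_rationally_stable_if_exponential[OF \<open>\<tau> > 0\<close> \<open>C > 0\<close>])
    show "\<mu> / 2 > 0" using \<mu> by simp
    fix \<phi> x and t :: real
    assume sol: "solution_from \<tau> (closed_loop \<tau> f (high_gain \<theta> K)) \<phi> x" and "t \<ge> 0"
    define p where "p = sup_norm \<tau> \<phi>"
    define \<eta> where "\<eta> s = scaling \<theta> *v x s" for s
    define g where "g s = scaling \<theta> *v f (x s) (x (s - \<tau>)) (high_gain \<theta> K \<bullet> x s)" for s
    define d where "d s = \<theta> *\<^sub>R (A\<^sub>K *v \<eta> s) + g s" for s
    define V where "V s = \<eta> s \<bullet> (S *v \<eta> s)" for s
    have x: "continuous_on {-\<tau>..} x"
      "\<And>s. s \<ge> 0 \<Longrightarrow> (x has_vector_derivative (chain_A *v x s + (high_gain \<theta> K \<bullet> x s) *\<^sub>R chain_B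
          + f (x s) (x (s - \<tau>)) (high_gain \<theta> K \<bullet> x s))) (at s within {0..})"
      using sol unfolding solution_from_def closed_loop_def plant_trajectory_def by blast+
    have d_eq: "d s = scaling \<theta> *v (chain_A *v x s + (high_gain \<theta> K \<bullet> x s) *\<^sub>R chain_B
          + f (x s) (x (s - \<tau>)) (high_gain \<theta> K \<bullet> x s))" for s
      unfolding matrix_vector_right_distrib[of _ "_ + _"] scaling_linear_part[OF \<open>\<theta> > 0\<close>]
        d_def g_def \<eta>_def assms(6) ..
    have \<eta>_d: "(\<eta> has_vector_derivative d s) (at s within {0..})" if "s \<ge> 0" for s
      unfolding \<eta>_def[abs_def] d_eq
      by (rule bounded_linear.has_vector_derivative[OF matrix_vector_mul_bounded_linear x(2)[OF that]])
    have g_le: "norm (g s) \<le> k * norm (\<eta> s) + k * norm (\<eta> (s - \<tau>))" for s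
    proof -
      \<comment> \<open>The Lipschitz inequality is applied against zero arguments with the same
        input value, where \<open>f\<close> vanishes.\<close>
      have "norm (g s) \<le> l\<^sub>1 * norm (\<eta> s) + l\<^sub>2 * norm (\<eta> (s - \<tau>))"
        using assms(5) \<open>scaled_lipschitz f \<theta> l\<^sub>1 l\<^sub>2\<close> unfolding scaled_lipschitz_def g_def \<eta>_def
        by (metis diff_zero)
      also have "\<dots> \<le> k * norm (\<eta> s) + k * norm (\<eta> (s - \<tau>))"
        using \<open>l\<^sub>1 \<le> k\<close> \<open>l\<^sub>2 \<le> k\<close> by (intro add_mono mult_right_mono) auto
      finally show ?thesis .
    qed
    have V_le: "V s \<le> m * (norm (\<eta> s))\<^sup>2" for s
      using inner_mult_vec_le[of "\<eta> s" S "\<eta> s"] by (simp add: V_def m_def power2_eq_square mult.assoc)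
    \<comment> \<open>The Lyapunov equation contributes \<open>- \<theta> * a\<^sup>2\<close>. One
      half absorbs \<open>\<mu> * V s\<close> and the undelayed part of the nonlinearity; the other
      half funds the memory integral, whose delayed term dominates
      \<open>k * m * b\<^sup>2\<close>.\<close>
    have V'_le: "2 * (\<eta> s \<bullet> (S *v d s)) + \<mu> * V s
        \<le> - (\<theta> / 2) * (norm (\<eta> s))\<^sup>2 + \<theta> / 2 * exp (- \<mu> * \<tau>) * (norm (\<eta> (s - \<tau>)))\<^sup>2" for s
    proof -
      define a b where "a = norm (\<eta> s)" and "b = norm (\<eta> (s - \<tau>))"
      have "\<eta> s \<bullet> (S *v g s) \<le> m * a * norm (g s)"
        unfolding m_def a_def by (rule inner_mult_vec_le)
      also have "\<dots> \<le> m * a * (k * a + k * b)"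
        using g_le[of s] \<open>m \<ge> 0\<close> by (intro mult_left_mono) (auto simp: a_def b_def)
      finally have "2 * (\<eta> s \<bullet> (S *v g s)) \<le> k * m * (2 * a\<^sup>2 + 2 * a * b)"
        by (simp add: algebra_simps power2_eq_square)
      \<comment> \<open>Splitting the mixed term by
        \<open>2 * a * b \<le> a\<^sup>2 + b\<^sup>2\<close> produces the coefficient 3 of the gain
        condition.\<close>
      also have "\<dots> \<le> k * m * (2 * a\<^sup>2 + (a\<^sup>2 + b\<^sup>2))"
        using \<open>k \<ge> 0\<close> \<open>m \<ge> 0\<close> sum_squares_bound[of a b] by (intro mult_left_mono) auto
      finally have "2 * (\<eta> s \<bullet> (S *v g s)) \<le> 3 * k * m * a\<^sup>2 + k * m * b\<^sup>2"
        by (simp add: algebra_simps)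
      moreover have "2 * (\<eta> s \<bullet> (S *v d s)) = - \<theta> * a\<^sup>2 + 2 * (\<eta> s \<bullet> (S *v g s))"
      proof -
        have "2 * (\<eta> s \<bullet> (S *v d s))
            = \<theta> * (2 * (\<eta> s \<bullet> (S *v (A\<^sub>K *v \<eta> s)))) + 2 * (\<eta> s \<bullet> (S *v g s))"
          by (simp add: d_def matrix_vector_right_distrib inner_add_right matrix_vector_mult_scaleR)
        then show ?thesis
          using lyapunov_equation_inner[of S A\<^sub>K "\<eta> s"] assms by (simp add: a_def)
      qed
      moreover have "\<mu> * V s \<le> \<mu> * m * a\<^sup>2"
        using V_le[of s] \<mu>(1) by (simp add: a_def mult.assoc)
      moreover have "0 \<le> (\<theta> / 2 - \<mu> * m - 3 * k * m) * a\<^sup>2" "0 \<le> (\<theta> / 2 * exp (- \<mu> * \<tau>) - k * m) * b\<^sup>2"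
        using \<mu> by simp_all
      ultimately show ?thesis
        unfolding a_def[symmetric] b_def[symmetric] by (simp add: algebra_simps)
    qed
    have \<eta>_p: "(norm (\<eta> s))\<^sup>2 \<le> p\<^sup>2" if "s \<in> {-\<tau>..0}" for s
    proof -
      have "norm (\<eta> s) \<le> norm (x s)" unfolding \<eta>_def by (rule norm_scaling_le) fact
      also have "\<dots> \<le> p"
        using norm_le_sup_norm[of \<tau> \<phi> s] sol that unfolding solution_from_def p_def by auto
      finally show ?thesis by (intro power_mono) auto
    qed
    have "p \<ge> 0"
      using order_trans[OF norm_ge_zero norm_le_sup_norm[of \<tau> \<phi> 0]] sol \<open>\<tau> > 0\<close>
      unfolding solution_from_def p_def by auto
    \<comment> \<open>The calculation substitutes inside monotone terms: the lower bound on
      \<open>V t\<close> under the exponential factor, the upper bound on \<open>V 0\<close> in the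
      sum. The decay lemma enters with \<open>q = \<theta> / 2\<close> and
      \<open>N = p\<^sup>2\<close>.\<close>
    have "c * (norm (\<eta> t))\<^sup>2 \<le> V t" unfolding V_def by (rule c(2))
    also have "exp (\<mu> * t) * V t \<le> V 0 + \<theta> / 2 * \<tau> * p\<^sup>2"
    proof (rule krasovskii_decay[where w = "\<lambda>s. (norm (\<eta> s))\<^sup>2" and V' = "\<lambda>s. 2 * (\<eta> s \<bullet> (S *v d s))"])
      show "continuous_on {-\<tau>..} (\<lambda>s. (norm (\<eta> s))\<^sup>2)"
        unfolding \<eta>_def by (intro continuous_intros x(1)
            bounded_linear.continuous_on[OF matrix_vector_mul_bounded_linear])
      show "(V has_real_derivative 2 * (\<eta> s \<bullet> (S *v d s))) (at s within {0..})" if "s \<ge> 0" for s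
        unfolding V_def using \<eta>_d[OF that] \<open>transpose S = S\<close>
        by (intro has_real_derivative_quadratic_form)
    qed (use assms \<mu> \<open>t \<ge> 0\<close> V'_le \<eta>_p in auto)
    also have "V 0 \<le> m * p\<^sup>2"
      using order_trans[OF V_le[of 0] mult_left_mono[OF \<eta>_p \<open>m \<ge> 0\<close>]] \<open>\<tau> > 0\<close> by auto
    finally have "exp (\<mu> * t) * (c * (norm (\<eta> t))\<^sup>2) \<le> G * p\<^sup>2"
      by (simp add: G_def algebra_simps)
    then have "(norm (\<eta> t))\<^sup>2 \<le> G / c * p\<^sup>2 / exp (\<mu> * t)"
      using c(1) by (simp add: field_simps)
    \<comment> \<open>Taking roots halves the rate, hence \<open>\<mu> / 2\<close>.\<close>
    also have "\<dots> = (sqrt (G / c) * exp (- (\<mu> / 2) * t) * p)\<^sup>2"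
    proof -
      have "(exp (- (\<mu> / 2) * t))\<^sup>2 = inverse (exp (\<mu> * t))"
        unfolding exp_double[symmetric] exp_minus[symmetric] by simp
      moreover have "(sqrt (G / c))\<^sup>2 = G / c" using c(1) \<open>G > 0\<close> by simp
      ultimately show ?thesis by (simp only: power_mult_distrib divide_inverse mult_ac)
    qed
    finally have "norm (\<eta> t) \<le> sqrt (G / c) * exp (- (\<mu> / 2) * t) * p"
      by (rule power2_le_imp_le) (use \<open>p \<ge> 0\<close> c(1) \<open>G > 0\<close> in simp)
    then have "\<theta> ^ CARD('n) * norm (\<eta> t) \<le> C * exp (- (\<mu> / 2) * t) * p"
      using assms by (simp add: C_def mult.assoc)
    then show "norm (x t) \<le> C * exp (- (\<mu> / 2) * t) * sup_norm \<tau> \<phi>"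
      using norm_le_scaling[OF theta_ge_1, of "x t"] by (simp add: \<eta>_def p_def)
  qed
qed

end
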